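(* Let $p$ be a prime and let $k\ge 2$ be an odd integer dividing $p-1$; write $p=km+1$. Let $0<\alpha_1<\alpha_2<\cdots<\alpha_m<p$ be all the $k$-th power residues modulo $p$ in the interval $(0,p)$, and let $$W_p(k)=\left[\left(\frac{\alpha_i+\alpha_j}{p}\right)\right]_{1\le i,j\le m},$$ where $\left(\frac{\cdot}{p}\right)$ is the Legendre symbol. Fix a primitive root $g$ modulo $p$ and define integers $c_p(k)$, $d_p(k)$ by $$p+1-c_p(k)=\#\{(x,y)\in\mathbb{F}_p\times\mathbb{F}_p:\ y^2=x(x^{2k}+1)\}+1,\qquad p+1-d_p(k)=\#\{(x,y)\in\mathbb{F}_p\times\mathbb{F}_p:\ y^2=x(x^{2k}+g^k)\}+1.$$ Then: (i) If $p\equiv 1\pmod 4$, then $\det W_p(k)=\frac{z_p(k)^2}{4k^2}\left(c_p(k)^2+d_p(k)^2\right)$ for some $z_p(k)\in\mathbb{Z}$. (ii) If $p\equiv 3\pmod 4$, then $-\det W_p(k)$ is the square of an integer.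
   Context: $\mathbb{F}_p$ denotes the finite field with $p$ elements. An integer $\alpha$ with $p\nmid\alpha$ is a $k$-th power residue modulo $p$ if $\alpha\equiv x^k\pmod p$ for some integer $x$. The "+1" in the definitions of $c_p(k)$, $d_p(k)$ accounts for a single point at infinity added to the affine points. *)

theory Defs
  imports
    "HOL-Number_Theory.Number_Theory"
    "Jordan_Normal_Form.Determinant"
begin

definition power_residue :: "nat \<Rightarrow> nat \<Rightarrow> int \<Rightarrow> bool" where
  "power_residue p k a \<longleftrightarrow> \<not> int p dvd a \<and> (\<exists>x::int. [a = x ^ k] (mod int p))"

text \<open>The matrix entries are indexed from 0, whereas the residues are numbered from 1.\<close>

definition W_mat :: "nat \<Rightarrow> nat \<Rightarrow> (nat \<Rightarrow> int) \<Rightarrow> int mat" where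
  "W_mat p m \<alpha> = mat m m (\<lambda>(i, j). Legendre (\<alpha> (Suc i) + \<alpha> (Suc j)) (int p))"

text \<open>The field with \<open>p\<close> elements is the library's residue ring, whose carrier consists of the
  integers \<open>0, \<dots>, p - 1\<close>; accordingly \<open>a mod p\<close> is the image of the integer \<open>a\<close> in it.\<close>

definition affine_points :: "nat \<Rightarrow> nat \<Rightarrow> int \<Rightarrow> (int \<times> int) set" where
  "affine_points p k a =
     (let F = residue_ring (int p) in
      {(x, y) \<in> carrier F \<times> carrier F.
         y [^]\<^bsub>F\<^esub> (2::nat) = x \<otimes>\<^bsub>F\<^esub> (x [^]\<^bsub>F\<^esub> (2 * k) \<oplus>\<^bsub>F\<^esub> (a mod int p))})"

end

theory Submission
  imports Defs
begin

text \<open>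
  Put \<open>h = g\<^sup>k\<close>, a generator of the group of \<open>k\<close>-th power residues, and
  \<open>c n = (1 + h\<^sup>n | p)\<close>, a function on the integers modulo \<open>m\<close>. Since \<open>h\<close> is a non-residue,
  \<open>(h\<^sup>i + h\<^sup>j | p) = (-1)\<^sup>i c (j - i)\<close>, so up to the sign \<open>(-1) ^ (m div 2)\<close> the determinant is
  that of the circulant matrix of \<open>c\<close>, and moreover \<open>c (-n) = (-1)\<^sup>n c n\<close>.

  If \<open>m div 2\<close> is odd, the ring \<open>\<int>[x]/(x\<^sup>m - 1)\<close> is compared with the rings modulo \<open>x ^ (m div 2) - 1\<close>
  and \<open>x ^ (m div 2) + 1\<close>; the substitution \<open>x \<mapsto> -x\<close> exchanges the last two and sends the generating
  polynomial \<open>f\<close> of \<open>c\<close> to its reversal, so \<open>f\<close> has the same norm in both.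

  If \<open>m div 2\<close> is even, \<open>\<i>\<^sup>n c n\<close> is an even function with period \<open>m\<close>. The eigenvalues of a
  symmetric circulant matrix coincide in pairs, except for those belonging to the characters
  \<open>\<plusminus>1\<close>, and here these two are \<open>f(\<i>)\<close> and \<open>f(-\<i>)\<close>. The remaining eigenvalues contribute the square
  of an explicit integer determinant, and counting points by means of \<open>x = g\<^sup>j\<close> yields
  \<open>c_p(k)\<^sup>2 + d_p(k)\<^sup>2 = 4 k\<^sup>2 f(\<i>) f(-\<i>)\<close>.
\<close>

subsection \<open>Determinants of circulant matrices\<close>

lemma det_mat_scale:
  fixes f :: "nat \<Rightarrow> nat \<Rightarrow> 'a :: comm_ring_1"
  shows "det (mat n n (\<lambda>(i, j). a i * b j * f i j)) =
           (\<Prod>i<n. a i) * (\<Prod>i<n. b i) * det (mat n n (\<lambda>(i, j). f i j))"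
proof -
  have "signof q * (\<Prod>i = 0..<n. mat n n (\<lambda>(i, j). a i * b j * f i j) $$ (i, q i)) =
      (\<Prod>i<n. a i) * (\<Prod>i<n. b i) *
        (signof q * (\<Prod>i = 0..<n. mat n n (\<lambda>(i, j). f i j) $$ (i, q i)))"
    if q: "q permutes {0..<n}" for q
  proof -
    have lt: "q i < n" if "i < n" for i
      using permutes_in_image[OF q, of i] that by simp
    have "(\<Prod>i = 0..<n. b (q i)) = (\<Prod>i = 0..<n. b i)"
      using prod.permute[OF q, of b] by (simp add: o_def)
    then show ?thesis
      using lt by (simp add: prod.distrib atLeast0LessThan algebra_simps)
  qed
  then show ?thesis
    by (subst (1 2) det_def'[of _ n]) (auto simp: sum_distrib_left intro!: sum.cong)
qed

text \<open>Conjugation by a diagonal matrix; applied below to signs \<open>(-1) ^ i\<close> and to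
  powers of \<open>\<i>\<close>.\<close>

lemma det_mat_conjugate:
  fixes f :: "nat \<Rightarrow> nat \<Rightarrow> 'a :: comm_ring_1"
  assumes "\<And>i. i < n \<Longrightarrow> a i * b i = 1"
  shows "det (mat n n (\<lambda>(i, j). a i * b j * f i j)) = det (mat n n (\<lambda>(i, j). f i j))"
proof -
  have "(\<Prod>i<n. a i) * (\<Prod>i<n. b i) = 1"
    using assms by (simp flip: prod.distrib)
  then show ?thesis
    by (simp add: det_mat_scale)
qed

text \<open>The same permutation acts on rows and on columns, so its sign enters twice and
  cancels.\<close>

lemma det_mat_reindex:
  fixes f :: "nat \<Rightarrow> nat \<Rightarrow> 'a :: comm_ring_1"
  assumes "bij_betw \<pi> {..<n} {..<n}"
  shows "det (mat n n (\<lambda>(i, j). f (\<pi> i) (\<pi> j))) = det (mat n n (\<lambda>(i, j). f i j))"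
proof -
  \<comment> \<open>Being a permutation in the library's sense requires fixing every point outside
    the set.\<close>
  define q where "q i = (if i < n then \<pi> i else i)" for i
  have "bij_betw q {0..<n} {0..<n}"
    using assms bij_betw_cong[of "{..<n}" q \<pi>] by (simp add: q_def atLeast0LessThan)
  then have q: "q permutes {0..<n}"
    by (rule bij_imp_permutes) (simp add: q_def)
  have lt: "\<pi> i < n" if "i < n" for i
    using assms that by (auto simp: bij_betw_def)
  let ?F = "mat n n (\<lambda>(i, j). f i j)"
  let ?G = "mat n n (\<lambda>(i, j). f (\<pi> i) j)"
  have "det ?G = det (mat n n (\<lambda>(i, j). ?F $$ (q i, j)))"
    by (rule arg_cong[of _ _ det], rule eq_matI) (auto simp: q_def lt)
  also have "\<dots> = signof q * det ?F"
    by (rule det_permute_rows[OF _ q]) simp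
  finally have G: "det ?G = signof q * det ?F" .
  have "det (mat n n (\<lambda>(i, j). f (\<pi> i) (\<pi> j))) =
      det (transpose_mat (mat n n (\<lambda>(i, j). f (\<pi> i) (\<pi> j))))"
    by (rule det_transpose[symmetric, where n = n]) simp
  also have "\<dots> = det (mat n n (\<lambda>(i, j). transpose_mat ?G $$ (q i, j)))"
    by (rule arg_cong[of _ _ det], rule eq_matI) (auto simp: q_def lt)
  also have "\<dots> = signof q * det (transpose_mat ?G)"
    by (rule det_permute_rows[OF _ q]) simp
  also have "\<dots> = signof q * det ?G"
    by (subst det_transpose[where n = n]) simp_all
  also have "\<dots> = (signof q * signof q) * det ?F"
    by (simp only: G mult.assoc)
  also have "signof q * signof q = (1 :: 'a)"
    by (simp add: sign_def)
  finally show ?thesis by simp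
qed

text \<open>Adding the lower block row to the upper one is undone on the columns: the unipotent
  \<open>?L\<close> satisfies \<open>?L * ?M = ?T * ?L\<close> with \<open>?T\<close> block
  triangular. Nothing is divided by 2, so the characteristic is arbitrary.\<close>

lemma det_four_block_mat_symmetric:
  fixes A B :: "'a :: idom mat"
  assumes A: "A \<in> carrier_mat n n" and B: "B \<in> carrier_mat n n"
  shows "det (four_block_mat A B B A) = det (A + B) * det (A - B)"
proof -
  let ?L = "four_block_mat (1\<^sub>m n) (1\<^sub>m n) (0\<^sub>m n n) (1\<^sub>m n) :: 'a mat"
  let ?M = "four_block_mat A B B A"
  let ?T = "four_block_mat (A + B) (0\<^sub>m n n) B (A - B)"
  have c: "?L \<in> carrier_mat (n + n) (n + n)" "?M \<in> carrier_mat (n + n) (n + n)"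
      "?T \<in> carrier_mat (n + n) (n + n)"
    using A B by auto
  have "?L * ?M = four_block_mat (A + B) (A + B) B A"
    using A B
    by (subst mult_four_block_mat[where ?nc1.0 = n and ?nc2.0 = n and
        ?nr1.0 = n and ?nr2.0 = n and ?n1.0 = n and ?n2.0 = n])
      (auto simp: comm_add_mat[OF A B])
  also have "\<dots> = ?T * ?L"
  proof -
    have "B + (A - B) = A" "0\<^sub>m n n + (A + B) = A + B"
      using A B by (auto intro!: eq_matI)
    then show ?thesis
      using A B
      by (subst mult_four_block_mat[where ?nc1.0 = n and ?nc2.0 = n and
          ?nr1.0 = n and ?nr2.0 = n and ?n1.0 = n and ?n2.0 = n]) auto
  qed
  finally have eq: "?L * ?M = ?T * ?L" .
  have "det ?L = 1"
    by (subst det_four_block_mat_lower_left_zero[where n = n and m = n]) auto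
  moreover have "det ?T = det (A + B) * det (A - B)"
    by (rule det_four_block_mat_upper_right_zero) (use A B in auto)
  ultimately show ?thesis
    using arg_cong[OF eq, of det] by (simp add: det_mult[OF c(1,2)] det_mult[OF c(3,1)])
qed

text \<open>Index differences are integers, so \<open>s\<close> is also evaluated at negative
  arguments. The matrix is a true circulant if \<open>s\<close> has period \<open>n\<close>;
  otherwise it is in general only Toeplitz, like the blocks \<open>A\<close> and \<open>B\<close> in
  \<open>circulant_double\<close>.\<close>

definition circulant :: "nat \<Rightarrow> (int \<Rightarrow> 'a) \<Rightarrow> 'a mat" where
  "circulant n s = mat n n (\<lambda>(i, j). s (int j - int i))"

lemma circulant_double:
  assumes "\<And>n. c (n + 2 * int M) = c n"
  defines "A \<equiv> circulant M c" and "B \<equiv> circulant M (\<lambda>n. c (n + int M))"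
  shows "circulant (2 * M) c = four_block_mat A B B A"
proof (rule eq_matI)
  have per: "c (x - int M) = c (x + int M)" for x
    using assms(1)[of "x - int M"] by (simp add: algebra_simps)
  fix i j
  assume "i < dim_row (four_block_mat A B B A)" "j < dim_col (four_block_mat A B B A)"
  then have "i < 2 * M" "j < 2 * M"
    by (auto simp: A_def circulant_def)
  then show "circulant (2 * M) c $$ (i, j) = four_block_mat A B B A $$ (i, j)"
    using per[of "int j - (int i - int M)"]
    by (auto simp: A_def B_def circulant_def of_nat_diff algebra_simps)
qed (auto simp: A_def circulant_def)

text \<open>The determinant factors as \<open>det (?A + ?B) * det (?A - ?B)\<close>, and conjugation
  by alternating signs turns \<open>?A - ?B\<close> into the transpose of
  \<open>?A + ?B\<close>.\<close>

lemma det_circulant_twisted_square: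
  fixes c :: "int \<Rightarrow> 'a :: idom"
  assumes "odd M"
    and periodic: "\<And>n. c (n + 2 * int M) = c n"
    and twisted: "\<And>n. c (- n) = (if even n then c n else - c n)"
  shows "det (circulant (2 * M) c) = (det (circulant M (\<lambda>n. c n + c (n + int M))))\<^sup>2"
proof -
  let ?A = "circulant M c" and ?B = "circulant M (\<lambda>n. c (n + int M))"
  let ?S = "circulant M (\<lambda>n. c n + c (n + int M))"
  have carrier: "?A \<in> carrier_mat M M" "?B \<in> carrier_mat M M"
    by (auto simp: circulant_def)
  have sum: "?A + ?B = ?S"
    by (auto simp: circulant_def)
  have per: "c (x - int M) = c (x + int M)" for x
    using periodic[of "x - int M"] by (simp add: algebra_simps)
  have flip: "c (i - j) = (if even (i - j) then c (j - i) else - c (j - i))" for i j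
    using twisted[of "j - i"] by auto
  \<comment> \<open>As \<open>M\<close> is odd, shifting by \<open>M\<close> reverses the parity and
    hence the sign of the twist; this absorbs the minus sign of \<open>?A - ?B\<close>.\<close>
  have flipM: "c (i - j + int M) = (if even (i - j) then - c (j - i + int M) else c (j - i + int M))" for i j
    using twisted[of "j - i + int M"] per[of "i - j"] \<open>odd M\<close> by (auto simp: algebra_simps)
  have "det (?A - ?B) = det (mat M M (\<lambda>(i, j). (-1) ^ i * (-1) ^ j *
          (c (int j - int i) - c (int j - int i + int M))))"
    by (subst det_mat_conjugate)
      (auto simp: circulant_def minus_mat_def simp flip: power_mult_distrib intro!: arg_cong[of _ _ det])
  also have "mat M M (\<lambda>(i, j). (-1) ^ i * (-1) ^ j *
          (c (int j - int i) - c (int j - int i + int M))) = transpose_mat ?S"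
  proof (rule eq_matI)
    fix i j
    assume "i < dim_row (transpose_mat ?S)" "j < dim_col (transpose_mat ?S)"
    then show "mat M M (\<lambda>(i, j). (-1) ^ i * (-1) ^ j *
          (c (int j - int i) - c (int j - int i + int M))) $$ (i, j) = transpose_mat ?S $$ (i, j)"
      using flip[of "int i" "int j"] flipM[of "int i" "int j"]
      by (auto simp: circulant_def minus_one_power_iff split: if_splits)
  qed (auto simp: circulant_def)
  also have "det \<dots> = det ?S"
    by (rule det_transpose[where n = M]) (simp add: circulant_def)
  finally show ?thesis
    using periodic
    by (simp add: circulant_double det_four_block_mat_symmetric[OF carrier] sum power2_eq_square)
qed

section \<open>Symmetric circulants, and the reduction to them when \<open>M\<close> is even\<close>

lemma sum_lessThan_add:
  fixes f :: "nat \<Rightarrow> 'a :: comm_monoid_add"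
  shows "(\<Sum>n<a + b. f n) = (\<Sum>n<a. f n) + (\<Sum>n<b. f (a + n))"
  by (induction b) (simp_all add: add.assoc)

text \<open>The vectors \<open>y\<^sup>n + y\<^sup>-\<^sup>1\<^sup>-\<^sup>n\<close> span the symmetric part, on which \<open>s\<close> acts by the matrix on the
  left; taking differences of consecutive ones splits off the trivial character.\<close>

lemma det_symmetric_part:
  fixes s :: "int \<Rightarrow> 'a :: idom"
  assumes "N > 0"
    and sym: "\<And>n. s (- n) = s n"
    and periodic: "\<And>n. s (n + 2 * int N) = s n"
  shows "det (mat N N (\<lambda>(i, j). s (int j - int i) + s (int i + int j + 1))) =
    (\<Sum>n<2 * N. s (int n)) *
      det (mat (N - 1) (N - 1) (\<lambda>(i, j). s (int j - int i) - s (int i + int j + 2)))"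
proof -
  define x where "x i j = s (int j - int i) + s (int i + int j + 1)" for i j :: nat
  define X where "X = mat N N (\<lambda>(i, j). x i j)"
  define Q where "Q = mat (N - 1) (N - 1) (\<lambda>(i, j). s (int j - int i) - s (int i + int j + 2))"
  \<comment> \<open>\<open>D\<close> is \<open>X\<close> conjugated by \<open>G\<close>. The inverse
    of \<open>G\<close> is lower triangular with all entries 1, so row \<open>i\<close> of
    \<open>D\<close> consists of the tail sums of row \<open>i\<close> of \<open>G * X\<close>; for
    \<open>i > 0\<close> these telescope to \<open>s (j - i) - s (i + j)\<close>, which is 0 at
    \<open>j = 0\<close> by symmetry.\<close>
  define dd where "dd i j = (if i = 0 then \<Sum>t = j..<N. x 0 t else if j = 0 then 0
      else s (int j - int i) - s (int i + int j))" for i j :: nat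
  define D where "D = mat N N (\<lambda>(i, j). dd i j)"
  define G :: "'a mat" where
    "G = mat N N (\<lambda>(i, j). if i = j then 1 else if i = Suc j then - 1 else 0)"
  have carrier: "X \<in> carrier_mat N N" "D \<in> carrier_mat N N" "G \<in> carrier_mat N N"
    by (auto simp: X_def D_def G_def)
  have sym': "s (a - b) = s (b - a)" for a b
    using sym[of "b - a"] by simp
  have "G * X = D * G"
  proof (rule eq_matI)
    fix i j
    assume "i < dim_row (D * G)" "j < dim_col (D * G)"
    then have ij: "i < N" "j < N"
      by (auto simp: D_def G_def)
    have "(G * X) $$ (i, j) = (\<Sum>t = 0..<N. (if i = t then 1 else if i = Suc t then - 1 else 0) * x t j)"
      using ij by (simp add: G_def X_def scalar_prod_def)
    also have "\<dots> = (\<Sum>t = 0..<N. (if t = i then x t j else 0) - (if Suc t = i then x t j else 0))"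
      by (rule sum.cong) auto
    also have "\<dots> = x i j - (\<Sum>t = 0..<N. if Suc t = i then x t j else 0)"
      using ij by (simp add: sum_subtractf)
    also have "(\<Sum>t = 0..<N. if Suc t = i then x t j else 0) = (if i = 0 then 0 else x (i - 1) j)"
      using ij by (cases i) auto
    finally have GX: "(G * X) $$ (i, j) = x i j - (if i = 0 then 0 else x (i - 1) j)" .
    have "(D * G) $$ (i, j) = (\<Sum>t = 0..<N. dd i t * (if t = j then 1 else if t = Suc j then - 1 else 0))"
      using ij by (simp add: G_def D_def scalar_prod_def)
    also have "\<dots> = (\<Sum>t = 0..<N. (if t = j then dd i t else 0) - (if t = Suc j then dd i t else 0))"
      by (rule sum.cong) auto
    also have "\<dots> = dd i j - (if Suc j < N then dd i (Suc j) else 0)"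
      using ij by (simp add: sum_subtractf)
    also have "\<dots> = x i j - (if i = 0 then 0 else x (i - 1) j)"
    proof (cases "i = 0")
      case True
      then show ?thesis
        using ij by (auto simp: dd_def sum.atLeast_Suc_lessThan)
    next
      case False
      then obtain i' where i': "i = Suc i'"
        by (cases i) auto
      \<comment> \<open>The telescoped expression vanishes at \<open>j = N\<close>, so the tail sums
        have no boundary term.\<close>
      have last: "s (int N - int i) = s (int N + int i)"
        using periodic[of "- int N - int i"] sym[of "int N + int i"] by (simp add: algebra_simps)
      show ?thesis
        using False ij last sym'[of "int j"  "int i"] sym'[of 1 "int i"]
        by (cases "Suc j < N")
          (auto simp: dd_def x_def i' algebra_simps sym not_less less_Suc_eq_le
             dest!: le_antisym split: if_splits)
    qed
    finally show "(G * X) $$ (i, j) = (D * G) $$ (i, j)"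
      using GX by simp
  qed (auto simp: G_def X_def D_def)
  moreover have "det G = 1"
    by (subst det_lower_triangular[where n = N])
      (auto simp: G_def prod_list_diag_prod)
  ultimately have "det X = det D"
    using det_mult[OF carrier(3,1)] det_mult[OF carrier(2,3)] by simp
  have "D = four_block_mat (mat 1 1 (\<lambda>_. dd 0 0)) (mat 1 (N - 1) (\<lambda>(i, j). dd 0 (Suc j)))
      (0\<^sub>m (N - 1) 1) Q"
    using \<open>N > 0\<close> by (intro eq_matI) (auto simp: D_def Q_def dd_def algebra_simps of_nat_diff)
  then have "det D = dd 0 0 * det Q"
    by (simp add: det_four_block_mat_lower_left_zero_col[where n = "N - 1"] Q_def det_single)
  moreover have "dd 0 0 = (\<Sum>n<2 * N. s (int n))"
  proof -
    \<comment> \<open>Reversing the order of summation gives \<open>s (N - t)\<close>, which equals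
      \<open>s (N + t)\<close> by symmetry and periodicity; so the corner entry sums
      \<open>s\<close> over a full period.\<close>
    have "(\<Sum>t<N. s (int t + 1)) = (\<Sum>t<N. s (int (N + t)))"
    proof -
      have "(\<Sum>t<N. s (int t + 1)) = (\<Sum>t<N. s (int (N - Suc t) + 1))"
        by (rule sum.nat_diff_reindex[symmetric])
      also have "\<dots> = (\<Sum>t<N. s (int (N + t)))"
      proof (rule sum.cong)
        fix t assume "t \<in> {..<N}"
        then show "s (int (N - Suc t) + 1) = s (int (N + t))"
          using periodic[of "- int N - int t"] sym[of "int N + int t"]
          by (simp add: of_nat_diff algebra_simps)
      qed simp
      finally show ?thesis .
    qed
    moreover have "(\<Sum>n<2 * N. s (int n)) = (\<Sum>n<N. s (int n)) + (\<Sum>t<N. s (int (N + t)))"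
      by (simp add: mult_2 sum_lessThan_add)
    ultimately show ?thesis
      by (simp add: dd_def x_def sum.distrib atLeast0LessThan add.commute)
  qed
  ultimately show ?thesis
    using \<open>det X = det D\<close> by (simp add: X_def Q_def x_def)
qed

text \<open>The reflection \<open>n\<close> to \<open>-1 - n\<close> commutes with a symmetric
  circulant. Its even and odd parts give \<open>A + B\<close> and \<open>A - B\<close>, and each of
  these splits off one of the characters 1 and -1, leaving the same \<open>Q\<close> up to
  conjugation.\<close>

lemma det_circulant_symmetric:
  fixes s :: "int \<Rightarrow> 'a :: idom"
  assumes "N > 0"
    and sym: "\<And>n. s (- n) = s n"
    and periodic: "\<And>n. s (n + 2 * int N) = s n"
  shows "det (circulant (2 * N) s) =
    (\<Sum>n<2 * N. s (int n)) * (\<Sum>n<2 * N. (-1) ^ n * s (int n)) *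
      (det (mat (N - 1) (N - 1) (\<lambda>(i, j). s (int j - int i) - s (int i + int j + 2))))\<^sup>2"
proof -
  define A where "A = mat N N (\<lambda>(i, j). s (int j - int i))"
  define B where "B = mat N N (\<lambda>(i, j). s (int i + int j + 1))"
  define Q where "Q = mat (N - 1) (N - 1) (\<lambda>(i, j). s (int j - int i) - s (int i + int j + 2))"
  \<comment> \<open>Reverses the second half: position \<open>N + j\<close> receives the index
    \<open>2 * N - 1 - j\<close>, which is \<open>-1 - j\<close> modulo
    \<open>2 * N\<close>.\<close>
  define \<pi> where "\<pi> i = (if i < N then i else 3 * N - 1 - i)" for i
  have carrier: "A \<in> carrier_mat N N" "B \<in> carrier_mat N N"
    by (auto simp: A_def B_def)
  have sym': "s (a - b) = s (b - a)" for a b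
    using sym[of "b - a"] by simp
  have "bij_betw \<pi> {..<2 * N} {..<2 * N}"
    by (rule bij_betwI[where g = \<pi>]) (auto simp: \<pi>_def)
  then have "det (circulant (2 * N) s) =
      det (mat (2 * N) (2 * N) (\<lambda>(i, j). s (int (\<pi> j) - int (\<pi> i))))"
    unfolding circulant_def by (subst det_mat_reindex[symmetric, where \<pi> = \<pi>]) simp_all
  also have "mat (2 * N) (2 * N) (\<lambda>(i, j). s (int (\<pi> j) - int (\<pi> i))) = four_block_mat A B B A"
  proof (rule eq_matI)
    fix i j
    assume "i < dim_row (four_block_mat A B B A)" "j < dim_col (four_block_mat A B B A)"
    then have ij: "i < 2 * N" "j < 2 * N"
      by (auto simp: A_def)
    have "s (int j - int (3 * N - 1 - i)) = s (int (i - N) + int j + 1)" if "N \<le> i"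
      using periodic[of "int j - int (3 * N - 1 - i)"] ij that by (simp add: of_nat_diff algebra_simps)
    moreover have "s (int (3 * N - 1 - j) - int i) = s (int i + int (j - N) + 1)" if "N \<le> j"
      using periodic[of "int i - int (3 * N - 1 - j)"] ij that
        sym'[of "int (3 * N - 1 - j)" "int i"] by (simp add: of_nat_diff algebra_simps)
    moreover have "s (int (3 * N - 1 - j) - int (3 * N - 1 - i)) = s (int (j - N) - int (i - N))"
      if "N \<le> i" "N \<le> j"
      using ij that sym'[of "int i" "int j"] by (simp add: of_nat_diff algebra_simps)
    ultimately show "mat (2 * N) (2 * N) (\<lambda>(i, j). s (int (\<pi> j) - int (\<pi> i))) $$ (i, j) =
        four_block_mat A B B A $$ (i, j)"
      using ij by (auto simp: A_def B_def \<pi>_def not_less)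
  qed (auto simp: A_def)
  also have "det \<dots> = det (A + B) * det (A - B)"
    by (rule det_four_block_mat_symmetric[OF carrier])
  also have "A + B = mat N N (\<lambda>(i, j). s (int j - int i) + s (int i + int j + 1))"
    by (auto simp: A_def B_def)
  also have "det \<dots> = (\<Sum>n<2 * N. s (int n)) * det Q"
    unfolding Q_def by (rule det_symmetric_part) fact+
  also have "det (A - B) = (\<Sum>n<2 * N. (-1) ^ n * s (int n)) * det Q"
  proof -
    \<comment> \<open>Twisting by the alternating character: \<open>j - i\<close> and
      \<open>i + j + 1\<close> have opposite parities, so conjugation by signs turns
      \<open>A - B\<close> into the \<open>A + B\<close> of \<open>s'\<close>.\<close>
    define s' where "s' n = (if even n then s n else - s n)" for n
    have "det (A - B) = det (mat N N (\<lambda>(i, j). (-1) ^ i * (-1) ^ j *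
            (s (int j - int i) - s (int i + int j + 1))))"
      by (subst det_mat_conjugate)
        (auto simp: A_def B_def minus_mat_def simp flip: power_mult_distrib
          intro!: arg_cong[of _ _ det])
    also have "\<dots> = det (mat N N (\<lambda>(i, j). s' (int j - int i) + s' (int i + int j + 1)))"
      by (rule arg_cong[of _ _ det], rule eq_matI) (auto simp: s'_def minus_one_power_iff)
    also have "\<dots> = (\<Sum>n<2 * N. s' (int n)) *
        det (mat (N - 1) (N - 1) (\<lambda>(i, j). s' (int j - int i) - s' (int i + int j + 2)))"
      by (rule det_symmetric_part) (use assms in \<open>auto simp: s'_def\<close>)
    also have "mat (N - 1) (N - 1) (\<lambda>(i, j). s' (int j - int i) - s' (int i + int j + 2)) =
        mat (N - 1) (N - 1) (\<lambda>(i, j). (-1) ^ i * (-1) ^ j *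
          (s (int j - int i) - s (int i + int j + 2)))"
      by (rule eq_matI) (auto simp: s'_def minus_one_power_iff)
    also have "det \<dots> = det Q"
      unfolding Q_def by (rule det_mat_conjugate) (simp flip: power_mult_distrib)
    also have "(\<Sum>n<2 * N. s' (int n)) = (\<Sum>n<2 * N. (-1) ^ n * s (int n))"
      by (rule sum.cong) (auto simp: s'_def minus_one_power_iff)
    finally show ?thesis .
  qed
  finally show ?thesis
    by (simp add: Q_def power2_eq_square)
qed

lemma sum_lessThan_double:
  fixes f :: "nat \<Rightarrow> 'a :: comm_monoid_add"
  shows "(\<Sum>n<2 * M. f n) = (\<Sum>j<M. f (2 * j)) + (\<Sum>j<M. f (2 * j + 1))"
  by (induction M) (simp_all add: ac_simps)

text \<open>Multiplying \<open>c n\<close> by the power \<open>n\<close> of \<open>\<i>\<close>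
  cancels the twist, since inverting that power also costs the sign \<open>(-1) ^ n\<close>; the
  period survives because \<open>M\<close> is even.\<close>

lemma det_circulant_twisted_sum_squares:
  fixes c :: "int \<Rightarrow> int"
  assumes "M > 0" "even M"
    and periodic: "\<And>n. c (n + 2 * int M) = c n"
    and twisted: "\<And>n. c (- n) = (if even n then c n else - c n)"
  shows "\<exists>z. det (circulant (2 * M) c) = z\<^sup>2 *
    ((\<Sum>j<M. (-1) ^ j * c (2 * int j))\<^sup>2 + (\<Sum>j<M. (-1) ^ j * c (2 * int j + 1))\<^sup>2)"
proof -
  define s :: "int \<Rightarrow> complex" where "s n = \<i> powi n * of_int (c n)" for n
  \<comment> \<open>This is the matrix of \<open>det_circulant_symmetric\<close> for
    \<open>s\<close> with its diagonal factors removed. The power \<open>2 * (i + 1)\<close> of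
    \<open>\<i>\<close> is \<open>- (-1) ^ i\<close>, whence the plus sign; the entries are
    integers, and so is the witness \<open>det Q\<close>.\<close>
  define Q where "Q = mat (M - 1) (M - 1)
    (\<lambda>(i, j). c (int j - int i) + (-1) ^ i * c (int i + int j + 2))"
  \<comment> \<open>\<open>A\<close> and \<open>B\<close> collect the even and odd indices, so that
    the two character sums of \<open>s\<close> are \<open>A + \<i> * B\<close> and its
    conjugate.\<close>
  define A where "A = (\<Sum>j<M. (-1) ^ j * c (2 * int j))"
  define B where "B = (\<Sum>j<M. (-1) ^ j * c (2 * int j + 1))"
  have i_neg: "\<i> powi (- n) = (if even n then \<i> powi n else - (\<i> powi n))" for n
    by (simp add: power_int_minus flip: power_int_inverse)
  have "\<i> powi (2 * int M) = 1"
    using \<open>even M\<close> by (auto simp: power_int_mult elim!: evenE)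
  then have s_periodic: "s (n + 2 * int M) = s n" for n
    by (simp add: s_def power_int_add periodic)
  have s_sym: "s (- n) = s n" for n
    by (simp add: s_def twisted i_neg)
  have i_quot: "\<i> powi (- int i) * \<i> ^ j = \<i> powi (int j - int i)" for i j
    by (simp add: power_int_diff power_int_minus field_simps)
  have s_even: "s (2 * int j) = (-1) ^ j * of_int (c (2 * int j))" for j
    by (simp add: s_def power_int_mult)
  have s_odd: "s (1 + 2 * int j) = \<i> * (-1) ^ j * of_int (c (2 * int j + 1))" for j
    by (simp add: s_def power_int_mult power_int_add add.commute)
  have s_diff: "s (int j - int i) - s (int i + int j + 2) = \<i> powi (- int i) * \<i> powi (int j) *
      of_int (c (int j - int i) + (-1) ^ i * c (int i + int j + 2))" for i j
  proof -
    have "\<i> powi (int i + int j + 2) = \<i> powi (2 * (int i + 1)) * \<i> powi (int j - int i)"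
      by (simp add: algebra_simps flip: power_int_add)
    also have "\<i> powi (2 * (int i + 1)) = - ((-1) ^ i)"
      by (simp add: power_int_mult power_int_add)
    finally show ?thesis
      by (simp add: s_def i_quot) (simp add: algebra_simps)
  qed
  have "of_int (det (circulant (2 * M) c)) = det (map_mat complex_of_int (circulant (2 * M) c))"
    by (rule of_int_hom.hom_det[symmetric])
  also have "map_mat complex_of_int (circulant (2 * M) c) =
      mat (2 * M) (2 * M) (\<lambda>(i, j). of_int (c (int j - int i)))"
    by (auto simp: circulant_def)
  also have "det \<dots> = det (mat (2 * M) (2 * M)
      (\<lambda>(i, j). \<i> powi (- int i) * \<i> powi (int j) * of_int (c (int j - int i))))"
    by (rule det_mat_conjugate[symmetric]) (simp add: i_quot)
  also have "mat (2 * M) (2 * M)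
      (\<lambda>(i, j). \<i> powi (- int i) * \<i> powi (int j) * of_int (c (int j - int i))) = circulant (2 * M) s"
    by (auto simp: circulant_def s_def i_quot)
  also have "det \<dots> = (\<Sum>n<2 * M. s (int n)) * (\<Sum>n<2 * M. (-1) ^ n * s (int n)) *
      (det (mat (M - 1) (M - 1) (\<lambda>(i, j). s (int j - int i) - s (int i + int j + 2))))\<^sup>2"
    by (rule det_circulant_symmetric) (use \<open>M > 0\<close> s_sym s_periodic in auto)
  also have "mat (M - 1) (M - 1) (\<lambda>(i, j). s (int j - int i) - s (int i + int j + 2)) =
      mat (M - 1) (M - 1) (\<lambda>(i, j). \<i> powi (- int i) * \<i> powi (int j) *
        of_int (c (int j - int i) + (-1) ^ i * c (int i + int j + 2)))"
    by (simp add: s_diff)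
  also have "det \<dots> = det (mat (M - 1) (M - 1) (\<lambda>(i, j).
        complex_of_int (c (int j - int i) + (-1) ^ i * c (int i + int j + 2))))"
    by (rule det_mat_conjugate) (simp add: i_quot)
  also have "mat (M - 1) (M - 1) (\<lambda>(i, j).
        complex_of_int (c (int j - int i) + (-1) ^ i * c (int i + int j + 2))) = map_mat of_int Q"
    by (auto simp: Q_def)
  also have "det \<dots> = of_int (det Q)"
    by (rule of_int_hom.hom_det)
  also have "(\<Sum>n<2 * M. s (int n)) = of_int A + \<i> * of_int B"
    unfolding sum_lessThan_double
    by (simp add: s_even s_odd A_def B_def sum_distrib_left mult.assoc)
  also have "(\<Sum>n<2 * M. (-1) ^ n * s (int n)) = of_int A - \<i> * of_int B"
    unfolding sum_lessThan_double
    by (simp add: s_even s_odd A_def B_def sum_distrib_left sum_negf mult.assoc)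
  also have "(of_int A + \<i> * of_int B) * (of_int A - \<i> * of_int B) = complex_of_int (A\<^sup>2 + B\<^sup>2)"
    by (simp add: algebra_simps power2_eq_square)
  finally have "complex_of_int (det (circulant (2 * M) c)) = of_int ((det Q)\<^sup>2 * (A\<^sup>2 + B\<^sup>2))"
    by simp
  then show ?thesis
    unfolding of_int_eq_iff A_def B_def by blast
qed

subsection \<open>Legendre symbols and point counts\<close>

lemma Legendre_cong:
  assumes "[a = b] (mod p)"
  shows "Legendre a p = Legendre b p"
proof -
  have "[a = 0] (mod p) \<longleftrightarrow> [b = 0] (mod p)"
    using assms by (metis cong_sym cong_trans)
  moreover have "QuadRes p a \<longleftrightarrow> QuadRes p b"
    unfolding QuadRes_def using assms by (metis cong_sym cong_trans)
  ultimately show ?thesis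
    by (simp add: Legendre_def)
qed

text \<open>Euler's criterion gives the congruence modulo \<open>p\<close>; both sides lie in {-1,
  0, 1}, so they differ by at most 2, which is less than \<open>p\<close>.\<close>

lemma Legendre_mult:
  assumes "prime p" "2 < p"
  shows "Legendre (a * b) (int p) = Legendre a (int p) * Legendre b (int p)"
proof -
  have "[Legendre (a * b) (int p) = (a * b) ^ ((p - 1) div 2)] (mod int p)"
    using assms by (rule euler_criterion)
  moreover have "[Legendre a (int p) * Legendre b (int p) =
      a ^ ((p - 1) div 2) * b ^ ((p - 1) div 2)] (mod int p)"
    using assms by (intro cong_mult euler_criterion)
  ultimately have "[Legendre (a * b) (int p) = Legendre a (int p) * Legendre b (int p)] (mod int p)"
    by (metis cong_sym cong_trans power_mult_distrib)
  then have "int p dvd Legendre (a * b) (int p) - Legendre a (int p) * Legendre b (int p)"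
    by (simp add: cong_iff_dvd_diff)
  moreover have "\<bar>Legendre (a * b) (int p) - Legendre a (int p) * Legendre b (int p)\<bar> < int p"
    using assms(2) by (auto simp: Legendre_def)
  ultimately show ?thesis
    using zdvd_imp_le[of "int p" "\<bar>Legendre (a * b) (int p) - Legendre a (int p) * Legendre b (int p)\<bar>"]
    by fastforce
qed

lemma card_square_roots_mod_prime:
  assumes "prime p" "2 < p"
  shows "int (card {y \<in> {0..int p - 1}. [y\<^sup>2 = t] (mod int p)}) = 1 + Legendre t (int p)"
proof -
  define S where "S = {y \<in> {0..int p - 1}. [y\<^sup>2 = t] (mod int p)}"
  have prime: "prime (int p)"
    using assms by simp
  consider "[t = 0] (mod int p)" | "\<not> [t = 0] (mod int p)" "\<not> QuadRes (int p) t"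
    | y where "\<not> [t = 0] (mod int p)" "QuadRes (int p) t" "[y\<^sup>2 = t] (mod int p)"
    unfolding QuadRes_def by blast
  then have "int (card S) = 1 + Legendre t (int p)"
  proof cases
    case 1
    have "S = {0}"
    proof (intro equalityI subsetI)
      fix y assume "y \<in> S"
      then have "int p dvd y\<^sup>2" "0 \<le> y" "y < int p"
        using 1 by (auto simp: S_def cong_0_iff cong_dvd_iff)
      moreover from this have "int p dvd y"
        using prime_dvd_power[OF prime] by blast
      ultimately show "y \<in> {0}"
        using zdvd_not_zless[of y "int p"] by force
    qed (use 1 assms in \<open>auto simp: S_def cong_sym_eq\<close>)
    then show ?thesis
      using 1 by (simp add: Legendre_def)
  next
    case 2
    then have "S = {}"
      by (auto simp: S_def QuadRes_def)
    then show ?thesis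
      using 2 by (simp add: Legendre_def)
  next
    case (3 y)
    have "\<not> int p dvd y"
    proof
      assume "int p dvd y"
      then have "int p dvd y\<^sup>2"
        by (simp add: power2_eq_square)
      then show False
        using 3 cong_dvd_iff[OF 3(3)] by (simp add: cong_0_iff)
    qed
    have "S = {y mod int p, (- y) mod int p}"
    proof (intro equalityI subsetI)
      fix z assume z: "z \<in> S"
      then have "[z\<^sup>2 = y\<^sup>2] (mod int p)"
        unfolding S_def using cong_trans[OF _ cong_sym[OF 3(3)]] by blast
      then have "int p dvd (z - y) * (z + y)"
        by (simp add: cong_iff_dvd_diff power2_eq_square algebra_simps)
      then have "[z = y] (mod int p) \<or> [z = - y] (mod int p)"
        using prime_dvd_multD[OF prime] by (auto simp: cong_iff_dvd_diff)
      then show "z \<in> {y mod int p, (- y) mod int p}"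
        using z by (auto simp: S_def cong_def)
    next
      fix z assume "z \<in> {y mod int p, (- y) mod int p}"
      then have "[z = y] (mod int p) \<or> [z = - y] (mod int p)" "0 \<le> z" "z < int p"
        using assms by auto
      then have "[z\<^sup>2 = y\<^sup>2] (mod int p)"
        using cong_pow[of z y "int p" 2] cong_pow[of z "- y" "int p" 2] by auto
      then show "z \<in> S"
        using \<open>0 \<le> z\<close> \<open>z < int p\<close> cong_trans[OF _ 3(3)] by (simp add: S_def)
    qed
    moreover have "y mod int p \<noteq> (- y) mod int p"
    proof
      assume "y mod int p = (- y) mod int p"
      then have "int p dvd 2 * y"
        by (simp add: mod_eq_dvd_iff)
      then have "int p dvd 2"
        using prime_dvd_multD[OF prime] \<open>\<not> int p dvd y\<close> by blast
      then show False
        using assms zdvd_imp_le[of "int p" 2] by simp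
    qed
    ultimately show ?thesis
      using 3 by (simp add: Legendre_def)
  qed
  then show ?thesis
    by (simp only: S_def)
qed

lemma card_affine_points:
  assumes "prime p" "2 < p"
  shows "int (card (affine_points p k a)) =
    int p + (\<Sum>x\<in>{1..int p - 1}. Legendre (x * (x ^ (2 * k) + a)) (int p))"
proof -
  interpret residues "int p" "residue_ring (int p)"
    using assms by unfold_locales auto
  let ?X = "{0..int p - 1}"
  have pow: "x [^]\<^bsub>residue_ring (int p)\<^esub> n = x ^ n mod int p" if "x \<in> ?X" for x and n :: nat
    using that pow_cong[of x n] by simp
  define R where "R x = {y \<in> ?X. [y\<^sup>2 = x * (x ^ (2 * k) + a)] (mod int p)}" for x
  have "x * ((x ^ (2 * k) mod int p + a mod int p) mod int p) mod int p =
      x * (x ^ (2 * k) + a) mod int p" for x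
    by (metis mod_mult_right_eq mod_add_eq)
  then have "affine_points p k a = Sigma ?X R"
    unfolding affine_points_def Let_def res_carrier_eq R_def
    by (auto simp: pow res_add_eq res_mult_eq cong_def)
  moreover have "finite (R x)" for x
    unfolding R_def by (rule finite_subset[of _ ?X]) auto
  ultimately have "int (card (affine_points p k a)) = (\<Sum>x\<in>?X. int (card (R x)))"
    by simp
  also have "\<dots> = (\<Sum>x\<in>?X. 1 + Legendre (x * (x ^ (2 * k) + a)) (int p))"
    unfolding R_def by (simp only: card_square_roots_mod_prime[OF assms])
  also have "\<dots> = int p + (\<Sum>x\<in>?X. Legendre (x * (x ^ (2 * k) + a)) (int p))"
    using assms by (simp add: sum.distrib)
  \<comment> \<open>The term at \<open>x = 0\<close> is zero; the remaining \<open>x\<close> are the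
    powers of a primitive root.\<close>
  also have "?X = insert 0 {1..int p - 1}"
    using assms by auto
  also have "(\<Sum>x\<in>insert 0 {1..int p - 1}. Legendre (x * (x ^ (2 * k) + a)) (int p)) =
      (\<Sum>x\<in>{1..int p - 1}. Legendre (x * (x ^ (2 * k) + a)) (int p))"
    by (simp add: Legendre_def)
  finally show ?thesis .
qed

lemma primroot_bij_betw:
  assumes "prime p" "residue_primroot p g"
  shows "bij_betw (\<lambda>j. int g ^ j mod int p) {..<p - 1} {1..int p - 1}"
proof -
  have "bij_betw (\<lambda>i. g ^ i mod p) {..<p - 1} {0<..<p}"
    using residue_primroot_is_generator[of p g] assms prime_gt_1_nat[of p]
    by (simp add: totient_prime totatives_prime)
  moreover have "bij_betw int {0<..<p} {1..int p - 1}"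
    by (rule bij_betwI[where g = nat]) auto
  ultimately have "bij_betw (int \<circ> (\<lambda>i. g ^ i mod p)) {..<p - 1} {1..int p - 1}"
    by (rule bij_betw_trans)
  then show ?thesis
    by (simp add: o_def zmod_int)
qed

text \<open>If \<open>g\<close> were a quadratic residue, Euler's criterion would make its order
  \<open>p - 1\<close> divide \<open>(p - 1) div 2\<close>.\<close>

lemma Legendre_primroot:
  assumes "prime p" "2 < p" "residue_primroot p g"
  shows "Legendre (int g) (int p) = - 1"
proof -
  have ord: "ord p g = p - 1" and "coprime p g"
    using assms by (auto simp: residue_primroot_def totient_prime)
  have "\<not> int p dvd int g"
    using \<open>coprime p g\<close> assms(1) by (metis coprime_absorb_left int_dvd_int_iff not_prime_unit)
  moreover have "Legendre (int g) (int p) \<noteq> 1"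
  proof
    assume "Legendre (int g) (int p) = 1"
    then have "[int g ^ ((p - 1) div 2) = 1] (mod int p)"
      using euler_criterion[OF assms(1,2), of "int g"] by (simp add: cong_sym_eq)
    then have "[g ^ ((p - 1) div 2) = 1] (mod p)"
      by (metis cong_int_iff of_nat_1 of_nat_power)
    then have "p - 1 dvd (p - 1) div 2"
      using ord_divides ord by metis
    then show False
      using assms(2) by (auto dest!: dvd_imp_le)
  qed
  ultimately show ?thesis
    by (auto simp: Legendre_def cong_0_iff split: if_splits)
qed

lemma Legendre_power_primroot:
  assumes "prime p" "2 < p" "residue_primroot p g"
  shows "Legendre (int g ^ j) (int p) = (-1) ^ j"
proof (induction j)
  case 0
  have "\<not> [1 = 0] (mod int p)" "QuadRes (int p) 1"
    using assms(2) by (auto simp: cong_0_iff QuadRes_def intro: exI[of _ 1])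
  then show ?case
    by (simp add: Legendre_def)
next
  case (Suc j)
  then show ?case
    by (simp add: Legendre_mult assms Legendre_primroot)
qed

subsection \<open>The matrix of power residues\<close>

lemma sum_lessThan_periodic:
  fixes f :: "nat \<Rightarrow> 'a :: semiring_1"
  assumes "\<And>j. f (j + M) = f j"
  shows "(\<Sum>j<r * M. f j) = of_nat r * (\<Sum>j<M. f j)"
proof -
  have shift: "f (r * M + j) = f j" for r j
  proof (induction r)
    case (Suc r)
    then show ?case
      using assms[of "r * M + j"] by (simp add: ac_simps)
  qed simp
  show ?thesis
  proof (induction r)
    case (Suc r)
    have "(\<Sum>j<Suc r * M. f j) = (\<Sum>j<r * M + M. f j)"
      by (simp add: add.commute)
    also have "\<dots> = of_nat (Suc r) * (\<Sum>j<M. f j)"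
      by (simp only: sum_lessThan_add shift Suc.IH) (simp add: distrib_right add.commute)
    finally show ?case .
  qed simp
qed

lemma prod_alternating_signs: "(\<Prod>i<2 * M. (-1) ^ i) = ((-1) ^ M :: 'a :: comm_ring_1)"
  by (induction M) simp_all

locale power_residues =
  fixes p k M g :: nat
  assumes prime: "prime p" and odd_k: "odd k" and p_eq: "p = k * (2 * M) + 1"
    and primroot: "residue_primroot p g"
begin

definition h :: int where
  "h = int g ^ k"

text \<open>\<open>h\<close> has order \<open>2 * M\<close> modulo \<open>p\<close>, so reducing the
  exponent first extends the function to negative arguments and builds in the period.\<close>

definition c :: "int \<Rightarrow> int" where
  "c n = Legendre (1 + h ^ nat (n mod (2 * int M))) (int p)"

lemma M_pos: "M > 0"
  using prime p_eq by (cases "M = 0") auto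

lemma p_gt_2: "2 < p"
  using p_eq M_pos odd_k by (cases k) auto

text \<open>The order of \<open>g\<close> is \<open>k * (2 * M)\<close>; the factor \<open>k\<close>
  cancels from both exponents and the modulus.\<close>

lemma h_power_eq_iff: "[h ^ i = h ^ j] (mod int p) \<longleftrightarrow> [i = j] (mod 2 * M)"
proof -
  have "coprime p g" and ord: "ord p g = k * (2 * M)"
    using primroot prime p_eq by (auto simp: residue_primroot_def totient_prime)
  have "[h ^ i = h ^ j] (mod int p) \<longleftrightarrow> [g ^ (k * i) = g ^ (k * j)] (mod p)"
    unfolding h_def by (simp flip: power_mult of_nat_power cong_int_iff)
  also have "\<dots> \<longleftrightarrow> [k * i = k * j] (mod k * (2 * M))"
    using order_divides_expdiff[OF \<open>coprime p g\<close>] ord by simp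
  also have "\<dots> \<longleftrightarrow> [i = j] (mod 2 * M)"
    using odd_k by (auto simp: cong_def mult_mod_right[symmetric] elim!: oddE)
  finally show ?thesis .
qed

lemma Legendre_h_power: "Legendre (h ^ i) (int p) = (-1) ^ i"
  using odd_k Legendre_power_primroot[OF prime p_gt_2 primroot, of "k * i"]
  by (simp add: h_def power_mult)

lemma Legendre_h_add: "Legendre (h ^ i + h ^ j) (int p) = (-1) ^ i * c (int j - int i)"
proof -
  let ?n = "nat ((int j - int i) mod (2 * int M))"
  have "[int (i + ?n) = int j] (mod int (2 * M))"
    using M_pos by (simp add: cong_def mod_simps)
  then have "[h ^ (i + ?n) = h ^ j] (mod int p)"
    by (simp add: h_power_eq_iff flip: cong_int_iff)
  then have "[h ^ i + h ^ (i + ?n) = h ^ i + h ^ j] (mod int p)"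
    by (intro cong_add) auto
  then have "Legendre (h ^ i + h ^ j) (int p) = Legendre (h ^ i * (1 + h ^ ?n)) (int p)"
    by (simp add: Legendre_cong distrib_left power_add)
  then show ?thesis
    by (simp add: Legendre_mult prime p_gt_2 Legendre_h_power c_def)
qed

lemma c_periodic: "c (n + 2 * int M) = c n"
  by (simp add: c_def)

text \<open>Evaluate the symbol of \<open>1 + h ^ a\<close> twice, factoring out either
  \<open>h ^ 0\<close> or \<open>h ^ a\<close>.\<close>

lemma c_twisted: "c (- n) = (if even n then c n else - c n)"
proof -
  define a where "a = nat (n mod (2 * int M))"
  have a: "int a = n mod (2 * int M)"
    using M_pos by (simp add: a_def)
  have "c n = c (int a)" "c (- n) = c (- int a)"
    by (simp_all add: c_def a mod_simps)
  moreover have "even n \<longleftrightarrow> even a"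
    using a by (metis dvd_mod_iff dvd_triv_left even_of_nat)
  moreover have "c (int a) = (-1) ^ a * c (- int a)"
    using Legendre_h_add[of 0 a] Legendre_h_add[of a 0] by (simp add: add.commute)
  ultimately show ?thesis
    by auto
qed

lemma bij_betw_h_power:
  "bij_betw (\<lambda>i. h ^ i mod int p) {..<2 * M} {a. 0 < a \<and> a < int p \<and> power_residue p k a}"
proof (rule bij_betw_imageI)
  show "inj_on (\<lambda>i. h ^ i mod int p) {..<2 * M}"
  proof (rule inj_onI)
    fix i j assume "i \<in> {..<2 * M}" "j \<in> {..<2 * M}" "h ^ i mod int p = h ^ j mod int p"
    then show "i = j"
      using h_power_eq_iff[of i j] by (simp add: cong_def)
  qed
  have ndvd: "\<not> int p dvd h ^ i" for i
    using Legendre_h_power[of i] by (auto simp: Legendre_def cong_0_iff)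
  show "(\<lambda>i. h ^ i mod int p) ` {..<2 * M} = {a. 0 < a \<and> a < int p \<and> power_residue p k a}"
  proof (intro equalityI subsetI)
    fix a assume "a \<in> (\<lambda>i. h ^ i mod int p) ` {..<2 * M}"
    then obtain i where a: "a = h ^ i mod int p"
      by auto
    have "a \<ge> 0" "a < int p" "\<not> int p dvd a"
      using ndvd[of i] p_gt_2 by (auto simp: a dvd_mod_iff)
    moreover from this have "a \<noteq> 0"
      by auto
    moreover have "[a = (int g ^ i) ^ k] (mod int p)"
      by (simp add: a h_def mult.commute flip: power_mult)
    ultimately show "a \<in> {a. 0 < a \<and> a < int p \<and> power_residue p k a}"
      unfolding power_residue_def by auto
  next
    fix a assume "a \<in> {a. 0 < a \<and> a < int p \<and> power_residue p k a}"
    then obtain x where a: "0 < a" "a < int p" "[a = x ^ k] (mod int p)" "\<not> int p dvd a"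
      by (auto simp: power_residue_def)
    \<comment> \<open>Now \<open>x\<close> is a power of \<open>g\<close> modulo \<open>p\<close>,
      so \<open>x ^ k\<close> is a power of \<open>h\<close>, whose exponent may be reduced modulo
      \<open>2 * M\<close>.\<close>
    have "\<not> int p dvd x"
      using a(3,4) odd_k by (metis cong_dvd_iff dvd_power odd_pos dvd_trans)
    then have "x mod int p \<noteq> 0"
      by (simp add: dvd_eq_mod_eq_0)
    moreover have "0 \<le> x mod int p" "x mod int p < int p"
      using p_gt_2 by auto
    ultimately have "x mod int p \<in> {1..int p - 1}"
      by auto
    then have "x mod int p \<in> (\<lambda>j. int g ^ j mod int p) ` {..<p - 1}"
      using bij_betw_imp_surj_on[OF primroot_bij_betw[OF prime primroot]] by simp
    then obtain i where "x mod int p = int g ^ i mod int p"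
      by (elim imageE)
    then have "[x ^ k = (int g ^ i) ^ k] (mod int p)"
      by (intro cong_pow) (simp add: cong_def)
    then have "[a = h ^ i] (mod int p)"
      using a(3) by (metis cong_trans h_def mult.commute power_mult)
    also have "[h ^ i = h ^ (i mod (2 * M))] (mod int p)"
      by (simp add: h_power_eq_iff)
    finally have "a = h ^ (i mod (2 * M)) mod int p"
      using a by (simp add: cong_def)
    then show "a \<in> (\<lambda>i. h ^ i mod int p) ` {..<2 * M}"
      using M_pos by (auto intro!: image_eqI[of _ _ "i mod (2 * M)"])
  qed
qed

text \<open>Listing the residues by size or as powers of \<open>h\<close> differs by one permutation
  \<pi> of rows and columns alike. The row factors \<open>(-1) ^ i\<close> then multiply to
  \<open>(-1) ^ M\<close>.\<close>

lemma det_W_mat: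
  assumes "strict_mono_on {1..2 * M} \<alpha>"
    and "\<alpha> ` {1..2 * M} = {a. 0 < a \<and> a < int p \<and> power_residue p k a}"
  shows "det (W_mat p (2 * M) \<alpha>) = (-1) ^ M * det (circulant (2 * M) c)"
proof -
  define R where "R = {a. 0 < a \<and> a < int p \<and> power_residue p k a}"
  define f where "f = (\<lambda>i. h ^ i mod int p)"
  have f: "bij_betw f {..<2 * M} R"
    using bij_betw_h_power by (simp add: f_def R_def)
  have "inj_on \<alpha> {1..2 * M}"
    using assms(1) by (rule strict_mono_on_imp_inj_on)
  then have "bij_betw \<alpha> {1..2 * M} R"
    using assms(2) by (simp add: bij_betw_def R_def)
  moreover have "bij_betw Suc {..<2 * M} {1..2 * M}"
    by (rule bij_betwI[where g = "\<lambda>i. i - 1"]) auto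
  ultimately have \<alpha>: "bij_betw (\<alpha> \<circ> Suc) {..<2 * M} R"
    by (metis bij_betw_trans)
  define \<pi> where "\<pi> = inv_into {..<2 * M} f \<circ> (\<alpha> \<circ> Suc)"
  have \<pi>: "bij_betw \<pi> {..<2 * M} {..<2 * M}"
    unfolding \<pi>_def by (rule bij_betw_trans[OF \<alpha> bij_betw_inv_into[OF f]])
  have f_\<pi>: "f (\<pi> i) = \<alpha> (Suc i)" if "i < 2 * M" for i
    using that bij_betw_inv_into_right[OF f, of "\<alpha> (Suc i)"] \<alpha>
    by (auto simp: \<pi>_def bij_betw_def)
  have "Legendre (\<alpha> (Suc i) + \<alpha> (Suc j)) (int p) = Legendre (h ^ \<pi> i + h ^ \<pi> j) (int p)"
    if "i < 2 * M" "j < 2 * M" for i j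
    by (rule Legendre_cong) (simp add: f_def cong_def mod_simps flip: f_\<pi>[OF that(1)] f_\<pi>[OF that(2)])
  then have "W_mat p (2 * M) \<alpha> =
      mat (2 * M) (2 * M) (\<lambda>(i, j). Legendre (h ^ \<pi> i + h ^ \<pi> j) (int p))"
    unfolding W_mat_def by (intro eq_matI) auto
  also have "det \<dots> = det (mat (2 * M) (2 * M) (\<lambda>(i, j). Legendre (h ^ i + h ^ j) (int p)))"
    by (rule det_mat_reindex[OF \<pi>])
  also have "\<dots> = det (mat (2 * M) (2 * M) (\<lambda>(i, j). (-1) ^ i * 1 * c (int j - int i)))"
    by (simp add: Legendre_h_add)
  also have "\<dots> = (-1) ^ M * det (circulant (2 * M) c)"
    by (subst det_mat_scale) (simp add: prod_alternating_signs circulant_def)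
  finally show ?thesis .
qed

text \<open>Substitute \<open>x = g ^ j\<close>: the factor \<open>x\<close> has symbol
  \<open>(-1) ^ j\<close>, and \<open>x ^ (2 * k)\<close> becomes
  \<open>h ^ (2 * j)\<close>.\<close>

lemma card_affine_points_primroot:
  "int (card (affine_points p k a)) =
    int p + (\<Sum>j<2 * k * M. (-1) ^ j * Legendre (h ^ (2 * j) + a) (int p))"
proof -
  have "(\<Sum>x\<in>{1..int p - 1}. Legendre (x * (x ^ (2 * k) + a)) (int p)) =
      (\<Sum>j<p - 1. Legendre (int g ^ j mod int p * ((int g ^ j mod int p) ^ (2 * k) + a)) (int p))"
    by (rule sum.reindex_bij_betw[OF primroot_bij_betw[OF prime primroot], symmetric])
  also have "\<dots> = (\<Sum>j<p - 1. Legendre (int g ^ j * (h ^ (2 * j) + a)) (int p))"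
  proof (rule sum.cong[OF refl], rule Legendre_cong)
    fix j
    have "(int g ^ j) ^ (2 * k) = h ^ (2 * j)"
      by (simp add: h_def ac_simps flip: power_mult)
    moreover have "[(int g ^ j mod int p) ^ (2 * k) = (int g ^ j) ^ (2 * k)] (mod int p)"
      by (intro cong_pow) simp
    ultimately show "[int g ^ j mod int p * ((int g ^ j mod int p) ^ (2 * k) + a) =
        int g ^ j * (h ^ (2 * j) + a)] (mod int p)"
      by (intro cong_mult cong_add) auto
  qed
  also have "\<dots> = (\<Sum>j<2 * k * M. (-1) ^ j * Legendre (h ^ (2 * j) + a) (int p))"
    by (simp add: Legendre_mult Legendre_power_primroot prime p_gt_2 primroot p_eq[symmetric])
       (simp add: p_eq ac_simps)
  finally show ?thesis
    by (simp add: card_affine_points prime p_gt_2)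
qed

text \<open>For even \<open>M\<close> the summand has period \<open>M\<close> in \<open>j\<close>,
  and the \<open>p - 1 = 2 * k * M\<close> terms cover \<open>2 * k\<close> periods.\<close>

lemma card_affine_points_1:
  assumes "even M"
  shows "int (card (affine_points p k 1)) =
    int p + 2 * int k * (\<Sum>j<M. (-1) ^ j * c (2 * int j))"
proof -
  have "Legendre (h ^ (2 * j) + 1) (int p) = c (2 * int j)" for j
    using Legendre_h_add[of 0 "2 * j"] by (simp add: add.commute)
  moreover have "(\<Sum>j<2 * k * M. (-1) ^ j * c (2 * int j)) =
      of_nat (2 * k) * (\<Sum>j<M. (-1) ^ j * c (2 * int j))"
    using assms c_periodic
    by (intro sum_lessThan_periodic) (simp add: power_add distrib_left)
  ultimately show ?thesis
    by (simp add: card_affine_points_primroot)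
qed

lemma card_affine_points_h:
  assumes "even M"
  shows "int (card (affine_points p k (int g ^ k))) =
    int p + 2 * int k * (\<Sum>j<M. (-1) ^ j * c (2 * int j + 1))"
proof -
  define F where "F j = (-1) ^ j * Legendre (h ^ (2 * j) + h) (int p)" for j
  have period: "F (j + M) = F j" for j
  proof -
    have "[h ^ (2 * (j + M)) = h ^ (2 * j)] (mod int p)"
      unfolding h_power_eq_iff by (simp add: cong_def distrib_left)
    then have "Legendre (h ^ (2 * (j + M)) + h) (int p) = Legendre (h ^ (2 * j) + h) (int p)"
      by (intro Legendre_cong cong_add) auto
    then show ?thesis
      using assms by (simp add: F_def power_add)
  qed
  \<comment> \<open>Factoring \<open>h\<close> out costs a sign, which the shift from
    \<open>j\<close> to \<open>Suc j\<close> cancels while turning the index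
    \<open>2 * j - 1\<close> into \<open>2 * j + 1\<close>; \<open>F M = F 0\<close> lets the
    shifted sum close up.\<close>
  have F_Suc: "F (Suc j) = (-1) ^ j * c (2 * int j + 1)" for j
    using Legendre_h_add[of 1 "2 * Suc j"] by (simp add: F_def algebra_simps)
  have "(\<Sum>j<M. F j) + F M = F 0 + (\<Sum>j<M. F (Suc j))"
    using sum.lessThan_Suc_shift[of F M] by simp
  then have "(\<Sum>j<M. F j) = (\<Sum>j<M. (-1) ^ j * c (2 * int j + 1))"
    using period[of 0] by (simp add: F_Suc)
  moreover have "(\<Sum>j<2 * k * M. F j) = of_nat (2 * k) * (\<Sum>j<M. F j)"
    by (intro sum_lessThan_periodic period)
  ultimately show ?thesis
    by (simp add: card_affine_points_primroot F_def flip: h_def)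
qed

end

theorem theorem1p2:
  fixes p k m g :: nat and \<alpha> :: "nat \<Rightarrow> int" and c d :: int
  assumes "prime p"
    and "k \<ge> 2" and "odd k" and "k dvd p - 1"
    and "p = k * m + 1"
    and "strict_mono_on {1..m} \<alpha>"
    and "\<alpha> ` {1..m} = {a. 0 < a \<and> a < int p \<and> power_residue p k a}"
    and "residue_primroot p g"
    and "int p + 1 - c = int (card (affine_points p k 1)) + 1"
    and "int p + 1 - d = int (card (affine_points p k (int g ^ k))) + 1"
  shows "([p = 1] (mod 4) \<longrightarrow>
            (\<exists>z::int. rat_of_int (det (W_mat p m \<alpha>)) =
               (of_int z)\<^sup>2 / (4 * (of_nat k)\<^sup>2) * ((of_int c)\<^sup>2 + (of_int d)\<^sup>2))) \<and>
         ([p = 3] (mod 4) \<longrightarrow> (\<exists>n::int. - det (W_mat p m \<alpha>) = n\<^sup>2))"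
proof -
  have "m > 0"
    using assms(1,5) by (cases "m = 0") auto
  then have "k \<le> k * m"
    by simp
  then have "odd p"
    using assms(1,2,5) prime_odd_nat[of p] by linarith
  then have "even m"
    using assms(3,5) by simp
  then obtain M where m: "m = 2 * M"
    by (elim evenE)
  interpret P: power_residues p k M g
    using assms by unfold_locales (auto simp: m)
  have det: "det (W_mat p m \<alpha>) = (-1) ^ M * det (circulant (2 * M) P.c)"
    unfolding m using assms(6,7) by (intro P.det_W_mat) (simp_all only: m)
  \<comment> \<open>With \<open>k = 2 * q + 1\<close>, \<open>p\<close> is \<open>2 * M + 1\<close>
    modulo 4, so the case split on \<open>p\<close> is one on the parity of
    \<open>M\<close>.\<close>
  have mod4: "p mod 4 = (if even M then 1 else 3)"
  proof -
    obtain q where "k = 2 * q + 1"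
      using \<open>odd k\<close> by (elim oddE)
    then have p: "p = 4 * (q * M) + 2 * M + 1"
      using assms(5) m by (simp add: algebra_simps)
    show ?thesis
    proof (cases "even M")
      case True
      then obtain N where "M = 2 * N" by (elim evenE)
      then have "p = 1 + 4 * (q * M + N)" using p by simp
      then show ?thesis using True by (simp only: mod_mult_self2) simp
    next
      case False
      then obtain N where "M = 2 * N + 1" by (elim oddE)
      then have "p = 3 + 4 * (q * M + N)" using p by simp
      then show ?thesis using False by (simp only: mod_mult_self2) simp
    qed
  qed
  show ?thesis
  proof (intro conjI impI)
    assume "[p = 1] (mod 4)"
    then have "p mod 4 = 1"
      by (simp add: cong_def)
    then have "even M"
      by (rule contrapos_pp) (simp add: mod4)
    define A where "A = (\<Sum>j<M. (-1) ^ j * P.c (2 * int j))"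
    define B where "B = (\<Sum>j<M. (-1) ^ j * P.c (2 * int j + 1))"
    \<comment> \<open>Hence \<open>c\<^sup>2 + d\<^sup>2\<close> is
      \<open>4 * k\<^sup>2 * (A\<^sup>2 + B\<^sup>2)\<close>, which cancels the denominator in the
      claim.\<close>
    have cd: "c = - (2 * int k * A)" "d = - (2 * int k * B)"
      using assms(9,10) P.card_affine_points_1[OF \<open>even M\<close>] P.card_affine_points_h[OF \<open>even M\<close>]
      by (simp_all add: A_def B_def)
    obtain z where "det (circulant (2 * M) P.c) = z\<^sup>2 * (A\<^sup>2 + B\<^sup>2)"
      using det_circulant_twisted_sum_squares[OF P.M_pos \<open>even M\<close> P.c_periodic P.c_twisted]
      unfolding A_def B_def by blast
    then have "det (W_mat p m \<alpha>) = z\<^sup>2 * (A\<^sup>2 + B\<^sup>2)"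
      using \<open>even M\<close> by (simp add: det)
    then have "rat_of_int (det (W_mat p m \<alpha>)) =
        (of_int z)\<^sup>2 / (4 * (of_nat k)\<^sup>2) * ((of_int c)\<^sup>2 + (of_int d)\<^sup>2)"
      using \<open>k \<ge> 2\<close> by (simp add: cd field_simps power_mult_distrib)
    then show "\<exists>z::int. rat_of_int (det (W_mat p m \<alpha>)) =
        (of_int z)\<^sup>2 / (4 * (of_nat k)\<^sup>2) * ((of_int c)\<^sup>2 + (of_int d)\<^sup>2)"
      by blast
  next
    assume "[p = 3] (mod 4)"
    then have "p mod 4 = 3"
      by (simp add: cong_def)
    then have "odd M"
      by (rule contrapos_pp) (simp add: mod4)
    \<comment> \<open>The sign \<open>(-1) ^ M\<close> is -1 here and accounts for the minus in
      front of the determinant.\<close>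
    then have "- det (W_mat p m \<alpha>) =
        (det (circulant M (\<lambda>n. P.c n + P.c (n + int M))))\<^sup>2"
      using det_circulant_twisted_square[OF _ P.c_periodic P.c_twisted] by (simp add: det)
    then show "\<exists>n::int. - det (W_mat p m \<alpha>) = n\<^sup>2"
      by blast
  qed
qed

end
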